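(* For every integer $k>1$, \[\sum_{n=1}^{\infty}\frac{(-1)^{n+1}}{T_k(n)} = k2^{k-1}\log 2 - k\sum_{i=1}^{k-1}\frac{2^{k-1-i}}{i}.\]
   Context: $\log$ denotes the natural logarithm. The generalized (higher-order) triangular numbers are defined by $T_0(n)=1$ for all positive integers $n$, and for each positive integer $k$, $T_k(n)=\sum_{i=1}^{n} T_{k-1}(i)$. Thus $T_1(n)=n$, $T_2(n)=n(n+1)/2$, and in general $T_k(n)=\frac{n(n+1)\cdots(n+k-1)}{k!}$. *)

theory Defs
  imports "HOL-Analysis.Analysis"
begin

(* Only arguments n >= 1 are meaningful; the values at n = 0 are never used,
   since the sum starts at 1. *)
fun gen_triangular :: "nat \<Rightarrow> nat \<Rightarrow> nat" where
  "gen_triangular 0 n = 1"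
| "gen_triangular (Suc k) n = (\<Sum>i = 1..n. gen_triangular k i)"

end

theory Submission
  imports Defs
begin

text \<open>Put \<open>b\<^sub>k(n) = 1 / (k T\<^sub>k(n))\<close>. Then \<open>b\<^sub>k(n) - b\<^sub>k(n+1) = b\<^sub>k\<^sub>+\<^sub>1(n)\<close>, so the alternating sums
  \<open>B\<^sub>k\<close> of \<open>b\<^sub>k\<close> satisfy \<open>B\<^sub>k\<^sub>+\<^sub>1 = 2 B\<^sub>k - b\<^sub>k(1) = 2 B\<^sub>k - 1/k\<close>. The recursion starts from the
  alternating harmonic series \<open>B\<^sub>1 = ln 2\<close>.\<close>

text \<open>Hockey-stick identity: the inner induction on \<open>n\<close> adds one term by Pascal's
  rule. The argument \<open>Suc n\<close> avoids truncated subtraction.\<close>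

lemma gen_triangular_Suc_eq_binomial: "gen_triangular k (Suc n) = (n + k) choose k"
proof (induction k arbitrary: n)
  case (Suc k)
  show ?case
    by (induction n) (use Suc in simp_all)
qed simp

lemma inverse_binomial_diff:
  assumes "k > 0"
  shows "1 / (real k * real ((n + k) choose k)) - 1 / (real k * real ((Suc n + k) choose k))
       = 1 / (real (Suc k) * real ((n + Suc k) choose Suc k))"
proof -
  define c N d where "c = real ((n + k) choose k)" and "N = real (Suc (n + k))"
    and "d = real ((Suc n + k) choose k)"
  have pos: "c > 0" "N > 0" "d > 0"
    by (simp_all add: c_def N_def d_def)
  \<comment> \<open>Absorption with lower index \<open>n\<close>, reached by symmetry; used again
    below with lower index \<open>k\<close>, it puts all three reciprocals over
    \<open>N * c\<close>.\<close>
  have "Suc (n + k) * ((n + k) choose k) = ((Suc n + k) choose k) * Suc n"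
    using Suc_times_binomial_eq[of "n + k" n] binomial_symmetric[of k "n + k"]
      binomial_symmetric[of k "Suc n + k"] by simp
  then have "N * c = d * real (Suc n)"
    unfolding c_def N_def d_def of_nat_mult[symmetric] by presburger
  then have d: "1 / d = real (Suc n) / (N * c)"
    using pos by simp
  have "Suc k * ((n + Suc k) choose Suc k) = Suc (n + k) * ((n + k) choose k)"
    using Suc_times_binomial_eq[of "n + k" k] by (simp add: mult.commute)
  then have e: "real (Suc k) * real ((n + Suc k) choose Suc k) = N * c"
    unfolding c_def N_def of_nat_mult[symmetric] by presburger
  have "1 / (real k * c) - 1 / (real k * d) = (1 / c - 1 / d) / real k"
    using assms pos by (simp add: field_simps)
  also have "1 / c - 1 / d = (N - real (Suc n)) / (N * c)"
    unfolding d using pos by (simp add: field_simps)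
  also have "N - real (Suc n) = real k"
    by (simp add: N_def)
  finally show ?thesis
    using assms e unfolding c_def d_def by simp
qed

text \<open>Shifting the series by one index flips the signs and drops \<open>f 0\<close>; the
  shifted series is added to the original.\<close>

lemma alternating_sums_forward_difference:
  fixes f :: "nat \<Rightarrow> real"
  assumes "(\<lambda>n. (-1) ^ n * f n) sums s"
  shows "(\<lambda>n. (-1) ^ n * (f n - f (Suc n))) sums (2 * s - f 0)"
proof -
  have "(\<lambda>n. (-1) ^ Suc n * f (Suc n)) sums (s - f 0)"
    using assms by (subst sums_Suc_iff) simp
  from sums_add[OF assms this] show ?thesis
    by (simp add: algebra_simps)
qed

lemma alternating_inverse_binomial_sums:
  "(\<lambda>n. (-1) ^ n * (1 / (real (Suc k) * real ((n + Suc k) choose Suc k)))) sums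
    (2 ^ k * ln 2 - (\<Sum>i = 1..k. 2 ^ (k - i) / real i))"
proof (induction k)
  case 0
  then show ?case
    using alternating_harmonic_series_sums by simp
next
  case (Suc k)
  have "(\<lambda>n. (-1) ^ n * (1 / (real (Suc (Suc k)) * real ((n + Suc (Suc k)) choose Suc (Suc k))))) sums
      (2 * (2 ^ k * ln 2 - (\<Sum>i = 1..k. 2 ^ (k - i) / real i)) - 1 / real (Suc k))"
    using alternating_sums_forward_difference[OF Suc.IH]
    unfolding inverse_binomial_diff[OF zero_less_Suc] by simp
  \<comment> \<open>Doubling raises each exponent by one; the subtracted
    \<open>1 / real (Suc k)\<close> becomes the new summand \<open>i = Suc k\<close>, with exponent
    0.\<close>
  moreover have "(\<Sum>i = 1..k. 2 ^ (Suc k - i) / real i) = 2 * (\<Sum>i = 1..k. 2 ^ (k - i) / real i)"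
    by (simp add: sum_distrib_left Suc_diff_le)
  ultimately show ?case
    by (simp add: algebra_simps)
qed

theorem theorem2p4:
  fixes k :: nat
  assumes "k > 1"
  shows "(\<lambda>n. (-1) ^ (Suc n + 1) / real (gen_triangular k (Suc n))) sums
    (real k * 2 ^ (k - 1) * ln 2 - real k * (\<Sum>i = 1..k - 1. 2 ^ (k - 1 - i) / real i))"
proof -
  from assms have k: "Suc (k - 1) = k" "real k \<noteq> 0" by simp_all
  \<comment> \<open>The factor \<open>real k\<close> cancels the normalisation of
    \<open>b\<^sub>k\<close>.\<close>
  have "(\<lambda>n. real k * ((-1) ^ n * (1 / (real k * real ((n + k) choose k))))) sums
      (real k * (2 ^ (k - 1) * ln 2 - (\<Sum>i = 1..k - 1. 2 ^ (k - 1 - i) / real i)))"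
    using sums_mult[OF alternating_inverse_binomial_sums[of "k - 1"], of "real k"]
    unfolding k(1) .
  then show ?thesis
    unfolding gen_triangular_Suc_eq_binomial using k(2)
    by (simp add: right_diff_distrib mult.assoc)
qed

end
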